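(* Let $a,b,f$ be as in the context, and suppose in addition that $b$ is of self-similar form $$b(x,y)=\frac1y h\left(\frac xy\right),\qquad 0<x<y,$$ where $h\in L_1((0,1),z\mathrm{d}z)$ is a nonnegative function with $\int_0^1 zh(z)\,\mathrm{d}z=1$. Suppose that $h\notin L_1(0,1)$. Define $H(z):=\int_0^z yh(y)\,\mathrm{d}y$ for $z\in[0,1]$, and assume that there are two positive and measurable functions $L\ge L_0$ on $(0,\infty)$ such that $$H\left(\frac zy\right)\le L(y)H(z),\qquad y\in(z,\infty),\ z\in(0,1),$$ $$H\left(\frac zy\right)\sim L_0(y)H(z)\ \text{ as } z\to0\ \text{ for all } y>0.$$ If $$\int_0^\infty y\,a(y)L(y)f(y)\,\mathrm{d}y<\infty,$$ then $$f(z)\sim\Lambda_0 z\int_z^1\frac{H(y)}{y^2}\,\mathrm{d}y\ \text{ as } z\to0,\qquad\text{where } \Lambda_0:=\int_0^\infty y\,a(y)L_0(y)f(y)\,\mathrm{d}y<\infty.$$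
   Context: For $m\in\mathbb{R}$, $X_m:=L_1((0,\infty),x^m\mathrm{d}x)$. Standing assumptions: $a\in L_{\infty,loc}([0,\infty))$, $a>0$ a.e. in $(0,\infty)$, and $\liminf_{x\to\infty}a(x)\in(0,\infty]$; $b$ is a positive measurable function on $(0,\infty)^2$ (only its values for $0<x<y$ matter) with $\int_0^y xb(x,y)\,\mathrm{d}x=y$ for all $y\in(0,\infty)$ and $\delta_2:=\inf_{y>0}\{1-y^{-2}\int_0^y x^2b(x,y)\,\mathrm{d}x\}>0$. Under these assumptions it is known that there is a unique nonnegative $f\in C([0,\infty))\cap C^\infty((0,\infty))$ solving $-f''(x)+a(x)f(x)=\int_x^\infty a(y)b(x,y)f(y)\,\mathrm{d}y$ for $x\in(0,\infty)$, $f(0)=0$, with $f\in\bigcap_{m>-1}X_m$, $af\in\bigcap_{m>-1}X_m$, $f''\in\bigcap_{m\ge1}X_m$, and $\int_0^\infty xf(x)\,\mathrm{d}x=1$; moreover $\lim_{z\to\infty}f(z)=\lim_{z\to\infty}zf'(z)=0$. This function is denoted $f$ throughout. The notation $u(z)\sim v(z)$ as $z\to0$ means $u(z)/v(z)\to1$. *)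

theory Defs
  imports "HOL-Analysis.Analysis" "HOL-Library.Landau_Symbols"
begin

text \<open>
  Functions on (half-)lines are total functions on the reals whose values off the relevant
  set are irrelevant; measurability is always Lebesgue measurability.
\<close>

definition X :: "real \<Rightarrow> (real \<Rightarrow> real) set" where
  "X m = {u. set_integrable lebesgue {0<..} (\<lambda>x. x powr m * u x)}"

definition Linf_loc :: "real set \<Rightarrow> (real \<Rightarrow> real) set" where
  "Linf_loc S = {u. u \<in> borel_measurable (lebesgue_on S) \<and>
     (\<forall>K. compact K \<and> K \<subseteq> S \<longrightarrow> (\<exists>C. AE x in lebesgue_on K. \<bar>u x\<bar> \<le> C))}"

text \<open>
  Since \<open>a\<close> is only determined almost everywhere, its lower limit at infinity is the
  essential one, i.e. the lower limit along the filter of sets containing almost every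
  sufficiently large point. Being in \<open>(0, \<infinity>]\<close> means being positive as an extended real.
\<close>

definition overall_fragmentation_rate :: "(real \<Rightarrow> real) \<Rightarrow> bool" where
  "overall_fragmentation_rate a \<longleftrightarrow>
     a \<in> Linf_loc {0..} \<and>
     (AE x in lebesgue_on {0<..}. 0 < a x) \<and>
     0 < Liminf (inf at_top (ae_filter lebesgue)) (\<lambda>x. ereal (a x))"

definition delta2 :: "(real \<Rightarrow> real \<Rightarrow> real) \<Rightarrow> real" where
  "delta2 b = (INF y\<in>{0<..}. 1 - (LINT x:{0<..<y}|lebesgue. x\<^sup>2 * b x y) / y\<^sup>2)"

text \<open>
  Only the values of \<open>b\<close> on \<open>0 < x < y\<close> matter. Positivity of \<open>b\<close> is non-strict, in
  accordance with self-similar kernels being generated by merely nonnegative \<open>h\<close>.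
  The mass balance forces integrability, a non-integrable function having integral 0.
\<close>

definition daughter_distribution :: "(real \<Rightarrow> real \<Rightarrow> real) \<Rightarrow> bool" where
  "daughter_distribution b \<longleftrightarrow>
     (\<lambda>(x, y). b x y) \<in> borel_measurable (lebesgue_on {(x, y). 0 < x \<and> x < y}) \<and>
     (\<forall>x y. 0 < x \<and> x < y \<longrightarrow> 0 \<le> b x y) \<and>
     (\<forall>y>0. (LINT x:{0<..<y}|lebesgue. x * b x y) = y) \<and>
     0 < delta2 b"

definition smooth_on :: "real set \<Rightarrow> (real \<Rightarrow> real) \<Rightarrow> bool" where
  "smooth_on S u \<longleftrightarrow> open S \<and> (\<forall>n. (deriv ^^ n) u differentiable_on S)"

text \<open>
  The equation is required almost everywhere, \<open>a\<close> being determined only almost everywhere.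
  For almost every \<open>x\<close> the integral on the right is that of an integrable function, by Tonelli,
  the mass balance for \<open>b\<close> and \<open>a f \<in> X 1\<close>.
\<close>

definition stationary_solution ::
  "(real \<Rightarrow> real) \<Rightarrow> (real \<Rightarrow> real \<Rightarrow> real) \<Rightarrow> (real \<Rightarrow> real) \<Rightarrow> bool" where
  "stationary_solution a b f \<longleftrightarrow>
     continuous_on {0..} f \<and> smooth_on {0<..} f \<and>
     (\<forall>x\<ge>0. 0 \<le> f x) \<and>
     (AE x in lebesgue_on {0<..}.
        - deriv (deriv f) x + a x * f x = (LINT y:{x<..}|lebesgue. a y * b x y * f y)) \<and>
     f 0 = 0 \<and>
     f \<in> (\<Inter>m\<in>{-1<..}. X m) \<and>
     (\<lambda>x. a x * f x) \<in> (\<Inter>m\<in>{-1<..}. X m) \<and>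
     deriv (deriv f) \<in> (\<Inter>m\<in>{1..}. X m) \<and>
     (LINT x:{0<..}|lebesgue. x * f x) = 1"

definition H :: "(real \<Rightarrow> real) \<Rightarrow> real \<Rightarrow> real" where
  "H h z = (LINT y:{0<..<z}|lebesgue. y * h y)"

end

theory Submission imports Defs begin

text \<open>
  Integrating \<open>x\<close> times the equation over \<open>(z, \<infinity>)\<close> and exchanging the order of integration,
  the self-similarity of \<open>b\<close> turns the gain term into
  \<open>f(z) - z f'(z) = G(z) := \<integral>\<^sub>z\<^sup>\<infinity> y a(y) f(y) H(z/y) dy\<close>, so that \<open>(f(z)/z)' = - G(z) / z\<^sup>2\<close>.
  By dominated convergence \<open>G(z) / H(z)\<close> tends to \<open>\<Lambda>\<^sub>0 > 0\<close>. Since \<open>h\<close> is not integrable,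
  \<open>\<integral>\<^sub>z\<^sup>1 H(y) / y\<^sup>2 dy\<close> diverges as \<open>z\<close> tends to 0, and l'Hopital's rule yields the claim.
  To apply Tonelli's theorem on the Borel product, \<open>h\<close> and \<open>a f\<close> are first replaced by
  Borel measurable representatives, called \<open>k\<close> and \<open>p\<close> below.
\<close>

section \<open>Borel representatives\<close>

text \<open>Lebesgue measure is the completion of Borel measure, so \<open>u\<close> agrees almost
  everywhere on \<open>S\<close> with a Borel function. Clipping that function at 0 and cutting it
  off outside \<open>S\<close> alters it only on a null subset of \<open>S\<close>, and makes sign
  and support hold at every point rather than almost everywhere.\<close>

lemma borel_representative:
  fixes u :: "real \<Rightarrow> real"
  assumes S: "S \<in> sets borel" and u: "set_borel_measurable lebesgue S u"
    and nonneg: "AE x in lebesgue. x \<in> S \<longrightarrow> 0 \<le> u x"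
  obtains v where "v \<in> borel_measurable borel" "\<And>x. 0 \<le> v x" "\<And>x. x \<notin> S \<Longrightarrow> v x = 0"
    "AE x in lborel. x \<in> S \<longrightarrow> u x = v x"
proof -
  have "(\<lambda>x. indicator S x * u x) \<in> borel_measurable (completion lborel)"
    using u by (simp add: set_borel_measurable_def)
  from completion_ex_borel_measurable_real[OF this] obtain w
    where [measurable]: "w \<in> borel_measurable borel" and w: "AE x in lborel. indicator S x * u x = w x"
    by auto
  have "AE x in lborel. x \<in> S \<longrightarrow> 0 \<le> u x"
    using nonneg by (simp add: AE_completion_iff)
  with w have "AE x in lborel. x \<in> S \<longrightarrow> u x = indicator S x * max 0 (w x)"
    by eventually_elim (auto simp: max_def)
  moreover have "(\<lambda>x. indicator S x * max 0 (w x)) \<in> borel_measurable borel"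
    using S by measurable
  ultimately show ?thesis
    by (intro that[of "\<lambda>x. indicator S x * max 0 (w x)"]) auto
qed

section \<open>Vanishing of the boundary term at infinity\<close>

lemma integrable_not_bounded_below_at_top:
  fixes u :: "real \<Rightarrow> real"
  assumes int: "set_integrable lborel {0<..} u" and nonneg: "\<And>x. 0 < x \<Longrightarrow> 0 \<le> u x"
    and d: "0 < d" and lb: "\<forall>\<^sub>F x in at_top. d \<le> u x"
  shows False
proof -
  obtain X where X: "0 < X" "\<And>x. X \<le> x \<Longrightarrow> d \<le> u x"
  proof -
    from lb obtain X where "\<And>x. X \<le> x \<Longrightarrow> d \<le> u x" by (auto simp: eventually_at_top_linorder)
    then show ?thesis by (intro that[of "max 1 X"]) auto
  qed
  have "real n * d \<le> (LINT x:{0<..}|lborel. u x)" for n :: nat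
  proof -
    have "real n * d = (LINT x|lborel. d * indicator {X..X + n} x)"
      by simp
    also have "\<dots> \<le> (LINT x|lborel. indicator {0<..} x *\<^sub>R u x)"
      using X nonneg int d unfolding set_integrable_def
      by (intro Bochner_Integration.integral_mono) (auto split: split_indicator simp: emeasure_lborel_Icc_eq)
    finally show ?thesis by (simp add: set_lebesgue_integral_def)
  qed
  moreover obtain n :: nat where "(LINT x:{0<..}|lborel. u x) / d < n"
    using reals_Archimedean2 by blast
  ultimately show False using d by (metis less_divide_eq not_less mult.commute pos_divide_less_eq)
qed

text \<open>The function \<open>W x = f x - x * f1 x\<close> has derivative
  \<open>- (x * f2 x)\<close>, so integrability of the latter gives \<open>W\<close> a limit
  \<open>c\<close> at infinity, and the claim amounts to \<open>c = 0\<close>. A nonzero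
  \<open>c\<close> of either sign would keep the nonnegative \<open>f\<close> above a positive
  constant near infinity, against its integrability.\<close>

lemma second_derivative_moment:
  fixes f f1 f2 :: "real \<Rightarrow> real"
  assumes f1: "\<And>x. 0 < x \<Longrightarrow> (f has_real_derivative f1 x) (at x)"
    and f2: "\<And>x. 0 < x \<Longrightarrow> (f1 has_real_derivative f2 x) (at x)"
    and cont: "continuous_on {0<..} f2"
    and int: "set_integrable lborel {0<..} (\<lambda>x. x * f2 x)"
    and f_int: "set_integrable lborel {0<..} f"
    and nonneg: "\<And>x. 0 < x \<Longrightarrow> 0 \<le> f x"
    and z: "0 < z"
  shows "(LINT x:{z..}|lborel. x * f2 x) = f z - z * f1 z"
proof -
  define W where "W x = f x - x * f1 x" for x
  define I where "I z = (LINT x:{z..}|lborel. x * f2 x)" for z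
  \<comment> \<open>The value that the limit of \<open>W\<close> must have, read off from
    \<open>W z - W T\<close> tending to \<open>I z\<close>.\<close>
  define c where "c = W z - I z"
  have W_deriv: "(W has_real_derivative - (x * f2 x)) (at x)" if "0 < x" for x
    unfolding W_def using f1[OF that] f2[OF that]
    by (auto intro!: derivative_eq_intros)
  have Icc: "(LINT x:{z..T}|lborel. x * f2 x) = W z - W T" if "z \<le> T" for T
  proof -
    have "(LINT x:{z..T}|lborel. x * f2 x) = (- W T) - (- W z)"
      unfolding set_lebesgue_integral_def
    proof (rule integral_FTC_Icc[OF that])
      show "continuous_on {z..T} (\<lambda>x. x * f2 x)"
        using z by (intro continuous_intros continuous_on_subset[OF cont]) auto
      fix x assume "z \<le> x" "x \<le> T"
      then have "((\<lambda>x. - W x) has_real_derivative x * f2 x) (at x within {z..T})"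
        using W_deriv[of x] z by (intro DERIV_subset[OF DERIV_minus[THEN DERIV_cong]]) auto
      then show "((\<lambda>x. - W x) has_vector_derivative x * f2 x) (at x within {z..T})"
        by (simp add: has_real_derivative_iff_has_vector_derivative)
    qed
    then show ?thesis by simp
  qed
  have W_lim: "(W \<longlongrightarrow> c) at_top"
  proof -
    have "integrable lborel (\<lambda>x. indicator {z..} x *\<^sub>R (x * f2 x))"
      using set_integrable_subset[OF int, of "{z..}"] z by (simp add: set_integrable_def subset_eq)
    from tendsto_integral_at_top[OF _ this]
    have "((\<lambda>T. LINT x|lborel. indicator {..T} x *\<^sub>R indicator {z..} x *\<^sub>R (x * f2 x)) \<longlongrightarrow> I z) at_top"
      by (simp add: I_def set_lebesgue_integral_def)
    then have "((\<lambda>T. W z - W T) \<longlongrightarrow> I z) at_top"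
    proof (rule Lim_transform_eventually)
      show "\<forall>\<^sub>F T in at_top. (LINT x|lborel. indicator {..T} x *\<^sub>R indicator {z..} x *\<^sub>R (x * f2 x)) = W z - W T"
        using eventually_ge_at_top[of z]
      proof eventually_elim
        case (elim T)
        have "(LINT x|lborel. indicator {..T} x *\<^sub>R indicator {z..} x *\<^sub>R (x * f2 x)) = (LINT x:{z..T}|lborel. x * f2 x)"
          unfolding set_lebesgue_integral_def
          by (intro Bochner_Integration.integral_cong) (auto split: split_indicator)
        then show ?case using Icc[OF elim] by simp
      qed
    qed
    from tendsto_diff[OF tendsto_const[of "W z"] this] show ?thesis by (simp add: c_def)
  qed
  \<comment> \<open>The sign of \<open>W\<close> thus decides the monotonicity of
    \<open>f x / x\<close>, which is exploited in both cases below.\<close>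
  have q_deriv: "((\<lambda>x. f x / x) has_real_derivative - W x / x\<^sup>2) (at x)" if "0 < x" for x
    using that by (auto intro!: derivative_eq_intros f1 simp: W_def power2_eq_square)
  have "c = 0"
  proof (rule ccontr)
    assume "c \<noteq> 0"
    then consider "0 < c" | "c < 0" by linarith
    then obtain d where "0 < d" "\<forall>\<^sub>F x in at_top. d \<le> f x"
    proof cases
      case 1
      then have "\<forall>\<^sub>F x in at_top. c / 2 < W x" using W_lim by (intro order_tendstoD) auto
      then obtain X where X: "\<And>x. X \<le> x \<Longrightarrow> c / 2 < W x" by (auto simp: eventually_at_top_linorder)
      have "c / 2 \<le> f x" if x: "max 1 X \<le> x" for x
      proof -
        \<comment> \<open>The correction \<open>c / 2 / x\<close> has derivative
          \<open>- (c / 2 / x\<^sup>2)\<close>, so \<open>c / 2 < W\<close> makes \<open>s\<close>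
          nonincreasing. Since \<open>s T\<close> is at least \<open>- (c / 2 / T)\<close>, letting
          \<open>T\<close> tend to infinity yields \<open>0 \<le> s x\<close>, which is
          \<open>c / 2 \<le> f x\<close>.\<close>
        define s where "s x = f x / x - c / 2 / x" for x
        have "s T \<le> s x" if T: "x \<le> T" for T
        proof (rule DERIV_nonpos_imp_nonincreasing[OF T])
          fix y assume y: "x \<le> y" "y \<le> T"
          then have "(s has_real_derivative - W y / y\<^sup>2 + c / 2 / y\<^sup>2) (at y)"
            unfolding s_def using x
            by (auto intro!: derivative_eq_intros q_deriv[THEN DERIV_cong] simp: power2_eq_square)
          moreover have "- W y / y\<^sup>2 + c / 2 / y\<^sup>2 \<le> 0"
          proof -
            have "- W y / y\<^sup>2 + c / 2 / y\<^sup>2 = (c / 2 - W y) / y\<^sup>2" by (simp add: diff_divide_distrib)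
            then show ?thesis using X[of y] x y by (simp add: divide_nonpos_nonneg)
          qed
          ultimately show "\<exists>l. (s has_real_derivative l) (at y) \<and> l \<le> 0" by blast
        qed
        moreover have "- (c / 2 / T) \<le> s T" if "x \<le> T" for T
          using nonneg[of T] that x by (simp add: s_def)
        ultimately have "- (c / 2 / T) \<le> s x" if "x \<le> T" for T
          using that by (meson order_trans)
        then have "\<forall>\<^sub>F T in at_top. - (c / 2 / T) \<le> s x"
          by (intro eventually_mono[OF eventually_ge_at_top[of x]])
        moreover have "((\<lambda>T::real. - (c / 2 / T)) \<longlongrightarrow> - 0) at_top"
          by (intro tendsto_minus tendsto_divide_0[OF tendsto_const] filterlim_at_top_imp_at_infinity filterlim_ident)
        ultimately have "0 \<le> s x"
          by (metis minus_zero tendsto_upperbound trivial_limit_at_top_linorder)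
        then show ?thesis using x by (simp add: s_def field_simps)
      qed
      then have "\<forall>\<^sub>F x in at_top. c / 2 \<le> f x"
        by (rule eventually_mono[OF eventually_ge_at_top])
      then show ?thesis using 1 that[of "c / 2"] by simp
    next
      case 2
      then have "\<forall>\<^sub>F x in at_top. W x < 0" using W_lim by (intro order_tendstoD) auto
      then obtain X where X: "\<And>x. X \<le> x \<Longrightarrow> W x < 0" by (auto simp: eventually_at_top_linorder)
      \<comment> \<open>Beyond \<open>X\<close> the quotient \<open>f x / x\<close> increases
        strictly, so it is positive from \<open>Y + 1\<close> on and stays above its value
        \<open>d\<close> there. The 1 in the maximum ensures \<open>f x / x \<le> f x\<close>, which
        carries the bound over to \<open>f\<close>.\<close>
      define Y where "Y = max 1 X"
      have mono: "f x / x < f y / y" if "Y \<le> x" "x < y" for x y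
      proof (rule DERIV_pos_imp_increasing[OF that(2)])
        fix u assume "x \<le> u" "u \<le> y"
        then have "0 < u" "W u < 0" using that X[of u] by (auto simp: Y_def)
        then show "\<exists>l. ((\<lambda>x. f x / x) has_real_derivative l) (at u) \<and> 0 < l"
          using q_deriv[of u] by (intro exI[of _ "- W u / u\<^sup>2"]) (auto intro: divide_neg_pos)
      qed
      define d where "d = f (Y + 1) / (Y + 1)"
      have "0 \<le> f Y / Y" using nonneg[of Y] by (simp add: Y_def)
      then have d: "0 < d" using mono[of Y "Y + 1"] by (simp add: d_def)
      have "d \<le> f x" if x: "Y + 1 \<le> x" for x
      proof -
        have "d \<le> f x / x"
          using mono[of "Y + 1" x] x by (cases "x = Y + 1") (auto simp: d_def)
        moreover have "f x / x \<le> f x" using nonneg[of x] x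
          by (auto simp: Y_def divide_le_eq mult_le_cancel_left1 max_def split: if_splits)
        ultimately show ?thesis by simp
      qed
      then have "\<forall>\<^sub>F x in at_top. d \<le> f x"
        by (rule eventually_mono[OF eventually_ge_at_top])
      then show ?thesis using d that[of d] by simp
    qed
    then show False using integrable_not_bounded_below_at_top[OF f_int nonneg] by blast
  qed
  then show ?thesis by (simp add: c_def W_def I_def)
qed

section \<open>Null sets and the passage between Lebesgue and Borel measure\<close>

text \<open>Completeness of Lebesgue measure lets measurability pass between functions that agree
  almost everywhere, so neither function has to be known to be measurable in advance.\<close>

lemma
  fixes u v :: "real \<Rightarrow> real"
  assumes ae: "AE x in lborel. x \<in> S \<longrightarrow> u x = v x"
  shows set_integrable_lebesgue_cong_AE: "set_integrable lebesgue S u \<longleftrightarrow> set_integrable lebesgue S v"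
    and set_integral_lebesgue_cong_AE: "(LINT x:S|lebesgue. u x) = (LINT x:S|lebesgue. v x)"
proof -
  define U V where "U x = indicator S x *\<^sub>R u x" and "V x = indicator S x *\<^sub>R v x" for x
  have UV: "AE x in lebesgue. U x = V x"
    using AE_completion[OF ae] by eventually_elim (auto simp: U_def V_def split: split_indicator)
  then have VU: "AE x in lebesgue. V x = U x" by eventually_elim simp
  have meas: "U \<in> borel_measurable lebesgue \<longleftrightarrow> V \<in> borel_measurable lebesgue"
    using borel_measurable_AE[OF _ UV] borel_measurable_AE[OF _ VU] by blast
  have "integrable lebesgue U \<longleftrightarrow> integrable lebesgue V"
    using integrable_cong_AE[of U lebesgue V] UV meas borel_measurable_integrable by blast
  then show "set_integrable lebesgue S u \<longleftrightarrow> set_integrable lebesgue S v"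
    by (simp add: set_integrable_def U_def[abs_def] V_def[abs_def])
  have "integral\<^sup>L lebesgue U = integral\<^sup>L lebesgue V"
  proof (cases "U \<in> borel_measurable lebesgue")
    case True
    then show ?thesis using meas UV by (intro integral_cong_AE) auto
  next
    \<comment> \<open>Without measurability neither function is integrable, and both integrals take
      the default value 0.\<close>
    case False
    then have "\<not> integrable lebesgue U" "\<not> integrable lebesgue V"
      using meas borel_measurable_integrable by blast+
    then show ?thesis by (simp add: not_integrable_integral_eq)
  qed
  then show "(LINT x:S|lebesgue. u x) = (LINT x:S|lebesgue. v x)"
    by (simp add: set_lebesgue_integral_def U_def[abs_def] V_def[abs_def])
qed

text \<open>The map sending \<open>t\<close> to \<open>x / t\<close> is its own inverse and
  differentiable away from 0, hence sends null sets to null sets. Every \<open>y\<close> at which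
  the conclusion fails lies in the image of the exceptional set \<open>N\<close>.\<close>

lemma AE_lborel_compose_divide:
  fixes x :: real
  assumes ae: "AE t in lborel. t \<in> {0<..<1} \<longrightarrow> Q t" and x: "0 < x"
  shows "AE y in lborel. x < y \<longrightarrow> Q (x / y)"
proof -
  define N where "N = {t \<in> {0<..<1}. \<not> Q t}"
  have "N \<in> null_sets lebesgue"
    using AE_completion[OF ae] by (simp add: completion.AE_iff_null_sets N_def)
  then have "negligible N" by (simp add: negligible_iff_null_sets)
  then have "negligible ((\<lambda>t. x / t) ` N)"
    by (rule negligible_differentiable_image_negligible[rotated])
       (auto intro!: derivative_intros simp: N_def differentiable_on_def)
  then have "AE y in lebesgue. y \<notin> (\<lambda>t. x / t) ` N"
    by (intro AE_not_in) (simp add: negligible_iff_null_sets)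
  then have "AE y in lebesgue. x < y \<longrightarrow> Q (x / y)"
  proof eventually_elim
    case (elim y)
    show ?case
    proof (rule impI, rule ccontr)
      assume y: "x < y" "\<not> Q (x / y)"
      then have "x / y \<in> N" using x by (simp add: N_def)
      moreover have "y = x / (x / y)" using x y by simp
      ultimately show False using elim by blast
    qed
  qed
  then show ?thesis by (simp add: AE_completion_iff)
qed

lemma set_integrable_lebesgue_iff:
  fixes v :: "real \<Rightarrow> real"
  assumes [measurable]: "v \<in> borel_measurable borel" "S \<in> sets borel"
  shows "set_integrable lebesgue S v \<longleftrightarrow> set_integrable lborel S v"
  unfolding set_integrable_def by (intro integrable_completion) measurable

section \<open>The function \<open>H\<close> of a Borel profile\<close>

text \<open>Models \<open>h\<close> after modification on a null set and extension by 0 outside the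
  open unit interval, so that the integrals run over the whole line with Borel integrands.\<close>

locale fragment_profile =
  fixes k :: "real \<Rightarrow> real"
  assumes k_measurable [measurable]: "k \<in> borel_measurable borel"
    and k_nonneg: "0 \<le> k t"
    and k_support: "t \<notin> {0<..<1} \<Longrightarrow> k t = 0"
    and first_moment_integrable: "integrable lborel (\<lambda>t. t * k t)"
    and first_moment: "(LINT t|lborel. t * k t) = 1"
    and not_integrable: "\<not> integrable lborel k"
begin

lemma moment_nonneg: "0 \<le> t * k t"
  using k_support[of t] k_nonneg[of t] by (cases "0 < t") auto

lemma truncated_integrable: "A \<in> sets borel \<Longrightarrow> integrable lborel (\<lambda>t. t * k t * indicator A t)"
  using integrable_mult_indicator[OF _ first_moment_integrable, of A] by (simp add: mult.commute)

lemma H_eq: "H k z = (LINT t|lborel. t * k t * indicator {..<z} t)"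
proof -
  have "H k z = (LINT t|lborel. indicator {0<..<z} t *\<^sub>R (t * k t))"
    unfolding H_def set_lebesgue_integral_def by (rule integral_completion) measurable
  also have "\<dots> = (LINT t|lborel. t * k t * indicator {..<z} t)"
    using k_support by (intro Bochner_Integration.integral_cong) (auto split: split_indicator)
  finally show ?thesis .
qed

lemma H_eq_nn_integral: "ennreal (H k z) = (\<integral>\<^sup>+t. ennreal (t * k t * indicator {..<z} t) \<partial>lborel)"
  unfolding H_eq using moment_nonneg
  by (intro nn_integral_eq_integral[symmetric] truncated_integrable AE_I2) auto

lemma one_minus_H_eq: "1 - H k z = (LINT t|lborel. t * k t * indicator {z..} t)"
proof -
  have "1 = (LINT t|lborel. t * k t * indicator {..<z} t + t * k t * indicator {z..} t)"
    unfolding first_moment[symmetric]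
    by (intro Bochner_Integration.integral_cong) (auto split: split_indicator)
  also have "\<dots> = H k z + (LINT t|lborel. t * k t * indicator {z..} t)"
    unfolding H_eq by (intro Bochner_Integration.integral_add truncated_integrable) auto
  finally show ?thesis by simp
qed

lemma one_minus_H_eq_nn_integral:
  "ennreal (1 - H k z) = (\<integral>\<^sup>+t. ennreal (t * k t * indicator {z..} t) \<partial>lborel)"
  unfolding one_minus_H_eq using moment_nonneg
  by (intro nn_integral_eq_integral[symmetric] truncated_integrable AE_I2) auto

lemma H_nonneg: "0 \<le> H k z"
  unfolding H_eq using moment_nonneg by (intro Bochner_Integration.integral_nonneg) auto

lemma H_le_1: "H k z \<le> 1"
proof -
  have "0 \<le> (LINT t|lborel. t * k t * indicator {z..} t)"
    using moment_nonneg by (intro Bochner_Integration.integral_nonneg) auto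
  then show ?thesis using one_minus_H_eq[of z] by simp
qed

lemma H_mono: "mono (H k)"
  unfolding H_eq using moment_nonneg
  by (intro monoI Bochner_Integration.integral_mono truncated_integrable) (auto split: split_indicator)

lemma H_measurable [measurable]: "H k \<in> borel_measurable borel"
  by (rule borel_measurable_mono[OF H_mono])

text \<open>Dominated convergence with majorant \<open>t * k t\<close>: as the upper end tends to
  \<open>z\<close>, the indicators converge at every \<open>t\<close> other than \<open>z\<close>
  itself.\<close>

lemma H_continuous: "continuous_on S (H k)"
proof -
  have "continuous (at z within UNIV) (H k)" for z
  proof (rule continuous_within_sequentiallyI)
    fix u :: "nat \<Rightarrow> real" assume u: "u \<longlonglongrightarrow> z"
    show "(\<lambda>n. H k (u n)) \<longlonglongrightarrow> H k z"
      unfolding H_eq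
    proof (rule integral_dominated_convergence[where w = "\<lambda>t. t * k t"])
      show "AE t in lborel. (\<lambda>n. t * k t * indicator {..<u n} t) \<longlonglongrightarrow> t * k t * indicator {..<z} t"
        using AE_lborel_singleton[of z]
      proof eventually_elim
        fix t :: real assume "t \<noteq> z"
        then consider "t < z" | "z < t" by linarith
        then have "\<forall>\<^sub>F n in sequentially. indicator {..<u n} t = (indicator {..<z} t :: real)"
        proof cases
          case 1
          from order_tendstoD(1)[OF u this] show ?thesis
            by eventually_elim (use 1 in simp)
        next
          case 2
          from order_tendstoD(2)[OF u this] show ?thesis
            by eventually_elim (use 2 in simp)
        qed
        then show "(\<lambda>n. t * k t * indicator {..<u n} t) \<longlonglongrightarrow> t * k t * indicator {..<z} t"
          by (intro tendsto_mult tendsto_const tendsto_eventually)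
      qed
      show "AE t in lborel. norm (t * k t * indicator {..<u n} t) \<le> t * k t" for n
        using moment_nonneg by (auto split: split_indicator)
    qed (use first_moment_integrable in auto)
  qed
  then show ?thesis
    by (simp add: continuous_at_imp_continuous_on)
qed

text \<open>If \<open>H k z\<close> were 0, then \<open>k\<close> would vanish almost everywhere
  below \<open>z\<close>. From \<open>z\<close> on, \<open>k t\<close> is at most
  \<open>t * k t / z\<close>, so \<open>k\<close> would be integrable altogether.\<close>

lemma H_pos:
  assumes "0 < z" shows "0 < H k z"
proof (rule ccontr)
  assume "\<not> 0 < H k z"
  then have "H k z = 0" using H_nonneg[of z] by simp
  then have "AE t in lborel. t * k t * indicator {..<z} t = 0"
    unfolding H_eq using moment_nonneg
    by (subst (asm) integral_nonneg_eq_0_iff_AE) (auto intro: truncated_integrable)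
  then have "AE t in lborel. norm (k t) \<le> norm (t * k t / z)"
  proof eventually_elim
    case (elim t)
    show ?case
    proof (cases "0 < t \<and> z \<le> t")
      case True
      then have "k t * z \<le> k t * t" using k_nonneg[of t] by (intro mult_left_mono) auto
      then show ?thesis using assms True k_nonneg[of t] by (simp add: field_simps)
    next
      case False
      then have "k t = 0" using elim k_support[of t] by (cases "0 < t") auto
      then show ?thesis by simp
    qed
  qed
  then have "integrable lborel k"
    by (intro Bochner_Integration.integrable_bound[OF integrable_divide_zero[OF first_moment_integrable]]) auto
  with not_integrable show False ..
qed

text \<open>Tonelli's theorem: for fixed \<open>t\<close> in the unit interval, integrating
  \<open>1 / y\<^sup>2\<close> from \<open>t\<close> to 1 gives \<open>1 / t - 1\<close>, and the
  weight \<open>t * k t\<close> turns this into \<open>(1 - t) * k t\<close>. Working in the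
  extended reals allows both sides to be infinite.\<close>

lemma nn_integral_H_div_square:
  "(\<integral>\<^sup>+y. ennreal (indicator {0<..1} y * (H k y / y\<^sup>2)) \<partial>lborel) = (\<integral>\<^sup>+t. ennreal ((1 - t) * k t) \<partial>lborel)"
proof -
  have "(\<integral>\<^sup>+y. ennreal (indicator {0<..1} y * (H k y / y\<^sup>2)) \<partial>lborel)
      = (\<integral>\<^sup>+y. (\<integral>\<^sup>+t. ennreal (indicator {0<..1} y / y\<^sup>2 * (t * k t * indicator {..<y} t)) \<partial>lborel) \<partial>lborel)"
  proof (intro nn_integral_cong)
    fix y :: real
    have "ennreal (indicator {0<..1} y * (H k y / y\<^sup>2)) = ennreal (indicator {0<..1} y / y\<^sup>2) * ennreal (H k y)"
      using H_nonneg[of y] by (subst ennreal_mult[symmetric]) (auto simp: field_simps)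
    also have "\<dots> = (\<integral>\<^sup>+t. ennreal (indicator {0<..1} y / y\<^sup>2) * ennreal (t * k t * indicator {..<y} t) \<partial>lborel)"
      unfolding H_eq_nn_integral by (rule nn_integral_cmult[symmetric]) measurable
    also have "\<dots> = (\<integral>\<^sup>+t. ennreal (indicator {0<..1} y / y\<^sup>2 * (t * k t * indicator {..<y} t)) \<partial>lborel)"
      using moment_nonneg by (intro nn_integral_cong ennreal_mult[symmetric]) auto
    finally show "ennreal (indicator {0<..1} y * (H k y / y\<^sup>2)) = \<dots>" .
  qed
  also have "\<dots> = (\<integral>\<^sup>+t. (\<integral>\<^sup>+y. ennreal (indicator {0<..1} y / y\<^sup>2 * (t * k t * indicator {..<y} t)) \<partial>lborel) \<partial>lborel)"
  proof (rule lborel_pair.Fubini')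
    have "(\<lambda>(t, y). ennreal (indicator {0<..1} y / y\<^sup>2 * (t * k t * indicator {..<y} t)))
        = (\<lambda>(t, y). ennreal (if t < y then indicator {0<..1} y / y\<^sup>2 * (t * k t) else 0))"
      by (auto split: split_indicator)
    also have "\<dots> \<in> borel_measurable (lborel \<Otimes>\<^sub>M lborel)"
      by measurable
    finally show "(\<lambda>(t, y). ennreal (indicator {0<..1} y / y\<^sup>2 * (t * k t * indicator {..<y} t))) \<in> borel_measurable (lborel \<Otimes>\<^sub>M lborel)" .
  qed
  also have "\<dots> = (\<integral>\<^sup>+t. ennreal ((1 - t) * k t) \<partial>lborel)"
  proof (intro nn_integral_cong)
    fix t :: real
    show "(\<integral>\<^sup>+y. ennreal (indicator {0<..1} y / y\<^sup>2 * (t * k t * indicator {..<y} t)) \<partial>lborel) = ennreal ((1 - t) * k t)"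
    proof (cases "t \<in> {0<..<1}")
      case True
      \<comment> \<open>The condition \<open>t < y\<close> is replaced by \<open>t \<le> y\<close>,
        which changes the integrand at most at one point and produces the closed interval for the
        fundamental theorem of calculus.\<close>
      have "AE y in lborel. ennreal (indicator {0<..1} y / y\<^sup>2 * (t * k t * indicator {..<y} t))
          = ennreal (t * k t / y\<^sup>2) * indicator {t..1} y"
        by (rule eventually_mono[OF AE_lborel_singleton[of t]]) (use True in \<open>auto split: split_indicator\<close>)
      then have "(\<integral>\<^sup>+y. ennreal (indicator {0<..1} y / y\<^sup>2 * (t * k t * indicator {..<y} t)) \<partial>lborel)
          = (\<integral>\<^sup>+y. ennreal (t * k t / y\<^sup>2) * indicator {t..1} y \<partial>lborel)"
        by (rule nn_integral_cong_AE)
      also have "\<dots> = ennreal (- (t * k t / 1) - (- (t * k t / t)))"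
        using True k_nonneg[of t]
        by (intro nn_integral_FTC_Icc) (auto intro!: derivative_eq_intros simp: power2_eq_square)
      also have "\<dots> = ennreal ((1 - t) * k t)" using True by (simp add: algebra_simps)
      finally show ?thesis .
    qed (simp add: k_support)
  qed
  finally show ?thesis .
qed

text \<open>Were the integral finite, \<open>(1 - t) * k t\<close> would be integrable, and adding
  the integrable \<open>t * k t\<close> would make \<open>k\<close> integrable.\<close>

lemma H_div_square_not_integrable: "\<not> integrable lborel (\<lambda>y. indicator {0<..1} y * (H k y / y\<^sup>2))"
proof
  assume "integrable lborel (\<lambda>y. indicator {0<..1} y * (H k y / y\<^sup>2))"
  then have "(\<integral>\<^sup>+y. ennreal (indicator {0<..1} y * (H k y / y\<^sup>2)) \<partial>lborel) < \<infinity>"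
    using H_nonneg by (subst nn_integral_eq_integral) (auto intro!: mult_nonneg_nonneg divide_nonneg_nonneg)
  moreover have "0 \<le> (1 - t) * k t" for t
    using k_nonneg[of t] k_support[of t] by (cases "t < 1") auto
  ultimately have "integrable lborel (\<lambda>t. (1 - t) * k t)"
    by (intro integrableI_nonneg) (auto simp: nn_integral_H_div_square[symmetric] simp del: times_divide_eq_right)
  from Bochner_Integration.integrable_add[OF this first_moment_integrable]
  have "integrable lborel k" by (simp add: algebra_simps)
  with not_integrable show False ..
qed

section \<open>Gain term and flux identity\<close>

text \<open>After exchanging the integrals, \<open>x\<close> runs from \<open>z\<close> to
  \<open>y\<close>. The substitution \<open>x = y * t\<close> has Jacobian \<open>y\<close>, and the
  factors combine to \<open>y * p y\<close> times the integral of \<open>t * k t\<close> over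
  \<open>{z / y..}\<close>, which is \<open>1 - H k (z / y)\<close> because the first moment of
  \<open>k\<close> is 1.\<close>

lemma nn_integral_gain:
  assumes [measurable]: "p \<in> borel_measurable borel" and p: "\<And>y. 0 \<le> p y" and z: "0 < z"
  shows "(\<integral>\<^sup>+x. ennreal (indicator {z..} x * x) *
            (\<integral>\<^sup>+y. ennreal (indicator {x<..} y * (p y / y * k (x / y))) \<partial>lborel) \<partial>lborel)
       = (\<integral>\<^sup>+y. ennreal (indicator {z<..} y * (y * p y * (1 - H k (z / y)))) \<partial>lborel)"
proof -
  define \<phi> where "\<phi> x y = indicator {z..} x * x * (indicator {x<..} y * (p y / y * k (x / y)))" for x y
  have \<phi>: "\<phi> x y = (if z \<le> x \<and> x < y then x * (p y / y * k (x / y)) else 0)" for x y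
    by (auto simp: \<phi>_def split: split_indicator)
  have "(\<integral>\<^sup>+x. ennreal (indicator {z..} x * x) *
            (\<integral>\<^sup>+y. ennreal (indicator {x<..} y * (p y / y * k (x / y))) \<partial>lborel) \<partial>lborel)
      = (\<integral>\<^sup>+x. (\<integral>\<^sup>+y. ennreal (\<phi> x y) \<partial>lborel) \<partial>lborel)"
  proof (intro nn_integral_cong)
    fix x :: real
    have "ennreal (indicator {z..} x * x) * (\<integral>\<^sup>+y. ennreal (indicator {x<..} y * (p y / y * k (x / y))) \<partial>lborel)
        = (\<integral>\<^sup>+y. ennreal (indicator {z..} x * x) * ennreal (indicator {x<..} y * (p y / y * k (x / y))) \<partial>lborel)"
      by (rule nn_integral_cmult[symmetric]) measurable
    also have "\<dots> = (\<integral>\<^sup>+y. ennreal (\<phi> x y) \<partial>lborel)"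
    proof (intro nn_integral_cong)
      fix y :: real
      show "ennreal (indicator {z..} x * x) * ennreal (indicator {x<..} y * (p y / y * k (x / y))) = ennreal (\<phi> x y)"
        unfolding \<phi>_def using p[of y] k_nonneg[of "x / y"] z
        by (cases "z \<le> x") (auto simp: ennreal_mult'[symmetric] split: split_indicator)
    qed
    finally show "ennreal (indicator {z..} x * x) * (\<integral>\<^sup>+y. ennreal (indicator {x<..} y * (p y / y * k (x / y))) \<partial>lborel)
        = (\<integral>\<^sup>+y. ennreal (\<phi> x y) \<partial>lborel)" .
  qed
  also have "\<dots> = (\<integral>\<^sup>+y. (\<integral>\<^sup>+x. ennreal (\<phi> x y) \<partial>lborel) \<partial>lborel)"
  proof (rule lborel_pair.Fubini')
    show "(\<lambda>(y, x). ennreal (\<phi> x y)) \<in> borel_measurable (lborel \<Otimes>\<^sub>M lborel)"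
      unfolding \<phi> by measurable
  qed
  also have "\<dots> = (\<integral>\<^sup>+y. ennreal (indicator {z<..} y * (y * p y * (1 - H k (z / y)))) \<partial>lborel)"
  proof (intro nn_integral_cong)
    fix y :: real
    show "(\<integral>\<^sup>+x. ennreal (\<phi> x y) \<partial>lborel) = ennreal (indicator {z<..} y * (y * p y * (1 - H k (z / y))))"
    proof (cases "z < y")
      case True
      then have y: "0 < y" using z by simp
      have "(\<integral>\<^sup>+x. ennreal (\<phi> x y) \<partial>lborel) = ennreal \<bar>y\<bar> * (\<integral>\<^sup>+t. ennreal (\<phi> (0 + y * t) y) \<partial>lborel)"
        by (rule nn_integral_real_affine) (use y in \<open>auto simp: \<phi>\<close>)
      also have "\<dots> = (\<integral>\<^sup>+t. ennreal y * ennreal (\<phi> (0 + y * t) y) \<partial>lborel)"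
        using y by (subst nn_integral_cmult) (auto simp: \<phi>)
      also have "\<dots> = (\<integral>\<^sup>+t. ennreal (y * p y) * ennreal (t * k t * indicator {z / y..} t) \<partial>lborel)"
      proof (intro nn_integral_cong)
        fix t :: real
        have "y * \<phi> (0 + y * t) y = y * p y * (t * k t * indicator {z / y..} t)"
        proof (cases "t \<in> {0<..<1}")
          case True
          then show ?thesis using y
            by (auto simp: \<phi> field_simps split: split_indicator)
        next
          case False
          then have "k t = 0" by (rule k_support)
          then show ?thesis using y by (simp add: \<phi>)
        qed
        then show "ennreal y * ennreal (\<phi> (0 + y * t) y) = ennreal (y * p y) * ennreal (t * k t * indicator {z / y..} t)"
          using y p[of y] by (metis ennreal_mult' less_imp_le mult_nonneg_nonneg)
      qed
      also have "\<dots> = ennreal (y * p y) * ennreal (1 - H k (z / y))"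
        unfolding one_minus_H_eq_nn_integral by (rule nn_integral_cmult) measurable
      also have "\<dots> = ennreal (y * p y * (1 - H k (z / y)))"
        using y p[of y] H_le_1[of "z / y"] by (intro ennreal_mult[symmetric]) auto
      finally show ?thesis using True by simp
    next
      case False
      then have "\<phi> x y = 0" for x by (simp add: \<phi>)
      then show ?thesis using False by simp
    qed
  qed
  finally show ?thesis .
qed

text \<open>Here \<open>p\<close> stands for the product of \<open>a\<close> and \<open>f\<close>.
  Multiplying \<open>eq\<close> by \<open>x\<close> and integrating over \<open>{z..}\<close> turns
  the gain into the integral of \<open>y * p y * (1 - H k (z / y))\<close>. Its part free of
  \<open>H k\<close> cancels against the loss term, and \<open>second_derivative_moment\<close>
  evaluates what remains, the integral of \<open>x * f2 x\<close>.\<close>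

lemma flux_identity:
  fixes f f1 f2 p :: "real \<Rightarrow> real"
  assumes f1: "\<And>x. 0 < x \<Longrightarrow> (f has_real_derivative f1 x) (at x)"
    and f2: "\<And>x. 0 < x \<Longrightarrow> (f1 has_real_derivative f2 x) (at x)"
    and cont: "continuous_on {0<..} f2"
    and f2_int: "set_integrable lborel {0<..} (\<lambda>x. x * f2 x)"
    and f_int: "set_integrable lborel {0<..} f"
    and nonneg: "\<And>x. 0 < x \<Longrightarrow> 0 \<le> f x"
    and p_meas [measurable]: "p \<in> borel_measurable borel" and p: "\<And>y. 0 \<le> p y"
    and p_int: "set_integrable lborel {0<..} (\<lambda>y. y * p y)"
    and eq: "AE x in lborel. 0 < x \<longrightarrow>
       p x - f2 x = enn2real (\<integral>\<^sup>+y. ennreal (indicator {x<..} y * (p y / y * k (x / y))) \<partial>lborel)"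
    and z: "0 < z"
  shows "f z - z * f1 z = (LINT y:{z<..}|lborel. y * p y * H k (z / y))"
proof -
  define N where "N x = (\<integral>\<^sup>+y. ennreal (indicator {x<..} y * (p y / y * k (x / y))) \<partial>lborel)" for x
  have N_meas [measurable]: "N \<in> borel_measurable borel"
  proof -
    have "(\<lambda>(x, y). ennreal (if x < y then p y / y * k (x / y) else 0)) \<in> borel_measurable (lborel \<Otimes>\<^sub>M lborel)"
      by measurable
    from lborel.borel_measurable_nn_integral_fst[OF this]
    have "(\<lambda>x. \<integral>\<^sup>+y. ennreal (if x < y then p y / y * k (x / y) else 0) \<partial>lborel) \<in> borel_measurable borel"
      by simp
    also have "(\<lambda>x. \<integral>\<^sup>+y. ennreal (if x < y then p y / y * k (x / y) else 0) \<partial>lborel) = N"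
      unfolding N_def by (intro ext nn_integral_cong) (auto split: split_indicator)
    finally show ?thesis .
  qed
  define g where "g y = indicator {z<..} y * (y * p y)" for y
  have g_nonneg: "0 \<le> g y" for y using p[of y] z by (auto simp: g_def split: split_indicator)
  have g_int: "integrable lborel g"
    using set_integrable_subset[OF p_int, of "{z<..}"] z by (simp add: set_integrable_def g_def[abs_def] subset_eq)
  have gH_int: "integrable lborel (\<lambda>y. g y * H k (z / y))"
    using H_nonneg H_le_1 g_nonneg
    by (intro Bochner_Integration.integrable_bound[OF g_int]) (auto simp: g_def abs_mult intro!: AE_I2 mult_left_le)
  have gain: "(\<integral>\<^sup>+x. ennreal (indicator {z..} x * x) * N x \<partial>lborel) = ennreal (LINT y|lborel. g y - g y * H k (z / y))"
  proof -
    have "(\<integral>\<^sup>+x. ennreal (indicator {z..} x * x) * N x \<partial>lborel)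
        = (\<integral>\<^sup>+y. ennreal (indicator {z<..} y * (y * p y * (1 - H k (z / y)))) \<partial>lborel)"
      unfolding N_def by (rule nn_integral_gain[OF p_meas p z])
    also have "\<dots> = (\<integral>\<^sup>+y. ennreal (g y - g y * H k (z / y)) \<partial>lborel)"
      by (intro nn_integral_cong) (simp add: g_def algebra_simps)
    also have "\<dots> = ennreal (LINT y|lborel. g y - g y * H k (z / y))"
      using g_nonneg H_le_1 by (intro nn_integral_eq_integral Bochner_Integration.integrable_diff g_int gH_int) (auto intro: mult_left_le)
    finally show ?thesis .
  qed
  \<comment> \<open>The total gain is finite, so \<open>N x\<close> is finite for almost every
    \<open>x\<close> in \<open>{z..}\<close>. There \<open>enn2real\<close> loses no information,
    and \<open>eq\<close> determines \<open>N x\<close> itself.\<close>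
  have "AE x in lborel. ennreal (indicator {z..} x * x) * N x \<noteq> \<infinity>"
    by (rule nn_integral_PInf_AE) (auto simp: gain)
  then have xN: "AE x in lborel. ennreal (indicator {z..} x * x) * N x = ennreal (indicator {z..} x * (x * p x) - indicator {z..} x * (x * f2 x))"
    using eq
  proof eventually_elim
    case (elim x)
    show ?case
    proof (cases "z \<le> x")
      case True
      then have "0 < x" using z by simp
      then have "N x \<noteq> top" using elim(1) True by (auto simp: ennreal_mult_top)
      then have "N x = ennreal (enn2real (N x))" by (simp add: less_top)
      also have "enn2real (N x) = p x - f2 x" using elim(2) \<open>0 < x\<close> by (simp add: N_def)
      finally have N: "N x = ennreal (p x - f2 x)" .
      then show ?thesis using True \<open>0 < x\<close>
        by (simp add: ennreal_mult'[symmetric] right_diff_distrib)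
    qed simp
  qed
  have nonneg': "AE x in lborel. 0 \<le> indicator {z..} x * (x * p x) - indicator {z..} x * (x * f2 x)"
    using eq
  proof eventually_elim
    case (elim x)
    show ?case
    proof (cases "z \<le> x")
      case True
      then have "0 \<le> x * (p x - f2 x)" using elim z enn2real_nonneg by auto
      then show ?thesis using True by (simp add: right_diff_distrib)
    qed simp
  qed
  have p_int': "integrable lborel (\<lambda>x. indicator {z..} x * (x * p x))"
    using set_integrable_subset[OF p_int, of "{z..}"] z by (simp add: set_integrable_def subset_eq)
  have f2_int': "integrable lborel (\<lambda>x. indicator {z..} x * (x * f2 x))"
    using set_integrable_subset[OF f2_int, of "{z..}"] z by (simp add: set_integrable_def subset_eq)
  have "ennreal (LINT y|lborel. g y - g y * H k (z / y)) = (\<integral>\<^sup>+x. ennreal (indicator {z..} x * (x * p x) - indicator {z..} x * (x * f2 x)) \<partial>lborel)"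
    unfolding gain[symmetric] using xN by (rule nn_integral_cong_AE)
  also have "\<dots> = ennreal (LINT x|lborel. indicator {z..} x * (x * p x) - indicator {z..} x * (x * f2 x))"
    by (intro nn_integral_eq_integral Bochner_Integration.integrable_diff p_int' f2_int' nonneg')
  finally have "(LINT y|lborel. g y - g y * H k (z / y)) = (LINT x|lborel. indicator {z..} x * (x * p x) - indicator {z..} x * (x * f2 x))"
  proof (rule ennreal_inj[THEN iffD1, rotated -1])
    show "0 \<le> (LINT y|lborel. g y - g y * H k (z / y))"
      using g_nonneg H_le_1 by (intro integral_nonneg_AE AE_I2) (auto intro: mult_left_le)
  qed (rule integral_nonneg_AE[OF nonneg'])
  moreover have "(LINT x|lborel. indicator {z..} x * (x * p x)) = (LINT y|lborel. g y)"
  proof (rule integral_cong_AE)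
    show "AE x in lborel. indicator {z..} x * (x * p x) = g x"
      by (rule eventually_mono[OF AE_lborel_singleton[of z]]) (auto simp: g_def split: split_indicator)
  qed (auto simp: g_def)
  moreover have "(LINT x|lborel. indicator {z..} x * (x * f2 x)) = f z - z * f1 z"
    using second_derivative_moment[OF f1 f2 cont f2_int f_int nonneg z]
    by (simp add: set_lebesgue_integral_def)
  ultimately have "f z - z * f1 z = (LINT y|lborel. g y * H k (z / y))"
    using g_int gH_int p_int' f2_int' by simp
  then show ?thesis
    by (simp add: set_lebesgue_integral_def g_def mult.assoc)
qed

section \<open>The comparison integral and the asymptotics at 0\<close>

text \<open>The integral grows as \<open>z\<close> decreases, so it suffices that it is unbounded
  along \<open>1 / Suc n\<close>. If it were bounded there, monotone convergence would make
  \<open>H k y / y\<^sup>2\<close> integrable up to 0, which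
  \<open>H_div_square_not_integrable\<close> excludes.\<close>

lemma H_div_square_integral_at_top:
  "filterlim (\<lambda>z. LINT y:{z..1}|lborel. H k y / y\<^sup>2) at_top (at_right 0)"
proof -
  define P where "P z = (LINT y:{z..1}|lborel. H k y / y\<^sup>2)" for z
  have int: "integrable lborel (\<lambda>y. indicator {z..1} y * (H k y / y\<^sup>2))" if "0 < z" for z
  proof -
    have "continuous_on {z..1} (\<lambda>y. H k y / y\<^sup>2)"
      using that by (intro continuous_intros H_continuous) auto
    then show ?thesis
      by (auto dest: borel_integrable_atLeastAtMost' simp: set_integrable_def)
  qed
  have mono: "P w \<le> P z" if "0 < z" "z \<le> w" for z w
    unfolding P_def set_lebesgue_integral_def real_scaleR_def using that H_nonneg
    by (intro Bochner_Integration.integral_mono int) (auto split: split_indicator intro: divide_nonneg_nonneg)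
  have unbounded: "\<exists>n::nat. B < P (1 / Suc n)" for B
  proof (rule ccontr)
    assume "\<nexists>n::nat. B < P (1 / Suc n)"
    then have B: "P (1 / Suc n) \<le> B" for n :: nat by (simp add: not_less)
    have "incseq (\<lambda>n. P (1 / Suc n))"
      by (intro incseq_SucI mono) (auto simp: frac_le)
    from incseq_convergent[OF this] B obtain l where l: "(\<lambda>n. P (1 / Suc n)) \<longlonglongrightarrow> l" by blast
    have "integrable lborel (\<lambda>y. indicator {0<..1} y * (H k y / y\<^sup>2))"
    proof (rule integrable_monotone_convergence)
      show "integrable lborel (\<lambda>y. indicator {1 / Suc n..1} y * (H k y / y\<^sup>2))" for n :: nat
        by (intro int) simp
      show "AE y in lborel. mono (\<lambda>n. indicator {1 / real (Suc n)..1} y * (H k y / y\<^sup>2))"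
      proof (intro AE_I2 monoI)
        fix y :: real and m n :: nat assume "m \<le> n"
        then have "1 / real (Suc n) \<le> 1 / real (Suc m)" by (simp add: frac_le)
        then show "indicator {1 / real (Suc m)..1} y * (H k y / y\<^sup>2) \<le> indicator {1 / real (Suc n)..1} y * (H k y / y\<^sup>2)"
          using H_nonneg[of y] by (auto split: split_indicator)
      qed
      show "AE y in lborel. (\<lambda>n. indicator {1 / real (Suc n)..1} y * (H k y / y\<^sup>2)) \<longlonglongrightarrow> indicator {0<..1} y * (H k y / y\<^sup>2)"
      proof (intro AE_I2 tendsto_mult tendsto_const tendsto_eventually)
        fix y :: real
        show "\<forall>\<^sub>F n in sequentially. indicator {1 / real (Suc n)..1} y = (indicator {0<..1} y :: real)"
        proof (cases "0 < y")
          case True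
          then have "\<forall>\<^sub>F n in sequentially. 1 / real (Suc n) < y"
            using LIMSEQ_inverse_real_of_nat by (intro order_tendstoD(2)) (simp_all add: inverse_eq_divide)
          then show ?thesis by eventually_elim (use True in \<open>auto split: split_indicator\<close>)
        next
          case False
          have "\<not> 1 / real (Suc n) \<le> y" for n
            using False by (metis divide_pos_pos less_le_trans of_nat_0_less_iff zero_less_Suc zero_less_one)
          then show ?thesis using False by (intro always_eventually) auto
        qed
      qed
      show "(\<lambda>n. LINT y|lborel. indicator {1 / real (Suc n)..1} y * (H k y / y\<^sup>2)) \<longlonglongrightarrow> l"
        using l by (simp add: P_def set_lebesgue_integral_def)
    qed measurable
    with H_div_square_not_integrable show False ..
  qed
  show ?thesis
    unfolding P_def[symmetric] filterlim_at_top_dense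
  proof
    fix B
    obtain n :: nat where n: "B < P (1 / Suc n)" using unbounded by blast
    show "\<forall>\<^sub>F z in at_right 0. B < P z"
    proof (rule eventually_mono[OF eventually_at_right_real])
      show "0 < 1 / real (Suc n)" by simp
      fix z assume "z \<in> {0<..<1 / real (Suc n)}"
      then show "B < P z" using mono[of z "1 / Suc n"] n by simp
    qed
  qed
qed

lemma H_div_square_integral_deriv:
  assumes z: "0 < z" "z < 1"
  shows "((\<lambda>z. LINT y:{z..1}|lborel. H k y / y\<^sup>2) has_real_derivative - (H k z / z\<^sup>2)) (at z)"
proof -
  \<comment> \<open>The base point \<open>z / 2\<close> used below keeps clear of the singularity at
    0. Near \<open>z\<close>, the integral over \<open>{w..1}\<close> is a constant minus the one
    over \<open>{z / 2..w}\<close>, which explains the negative sign.\<close>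
  define \<phi> where "\<phi> y = H k y / y\<^sup>2" for y
  have cont: "continuous_on {z / 2..1} \<phi>"
    unfolding \<phi>_def using z by (intro continuous_intros H_continuous) auto
  have int: "set_integrable lborel {w..1} \<phi>" if "z / 2 \<le> w" for w
    using that by (intro borel_integrable_atLeastAtMost' continuous_on_subset[OF cont]) auto
  have "((\<lambda>w. integral {z / 2..w} \<phi>) has_real_derivative \<phi> z) (at z within {z / 2..1})"
    using z by (intro integral_has_real_derivative cont) auto
  then have "((\<lambda>w. integral {z / 2..w} \<phi>) has_real_derivative \<phi> z) (at z)"
    by (subst (asm) at_within_interior) (use z in auto)
  then have "((\<lambda>w. integral {z / 2..1} \<phi> - integral {z / 2..w} \<phi>) has_real_derivative 0 - \<phi> z) (at z)"
    by (intro DERIV_diff DERIV_const)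
  then have "((\<lambda>w. LINT y:{w..1}|lborel. \<phi> y) has_real_derivative 0 - \<phi> z) (at z)"
  proof (rule has_field_derivative_transform_within_open[where S = "{z / 2<..<1}"])
    fix w assume w: "w \<in> {z / 2<..<1}"
    have "integral {z / 2..w} \<phi> + integral {w..1} \<phi> = integral {z / 2..1} \<phi>"
      using w cont by (intro Henstock_Kurzweil_Integration.integral_combine integrable_continuous_real) auto
    moreover have "(LINT y:{w..1}|lborel. \<phi> y) = integral {w..1} \<phi>"
      using w by (intro set_borel_integral_eq_integral int) auto
    ultimately show "integral {z / 2..1} \<phi> - integral {z / 2..w} \<phi> = (LINT y:{w..1}|lborel. \<phi> y)"
      by simp
  qed (use z in auto)
  then show ?thesis by (simp add: \<phi>_def)
qed

text \<open>The dominating function is \<open>y p(y) L(y)\<close>, since \<open>H(z/y) / H(z) \<le> L(y)\<close>.\<close>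

lemma flux_div_H_tendsto:
  fixes p L L0 :: "real \<Rightarrow> real"
  assumes [measurable]: "p \<in> borel_measurable borel" and p: "\<And>y. 0 \<le> p y"
    and L0_meas: "set_borel_measurable lebesgue {0<..} L0"
    and int: "set_integrable lebesgue {0<..} (\<lambda>y. y * p y * L y)"
    and bound: "\<And>z y. z \<in> {0<..<1} \<Longrightarrow> z < y \<Longrightarrow> H k (z / y) \<le> L y * H k z"
    and equiv: "\<And>y. y > 0 \<Longrightarrow> (\<lambda>z. H k (z / y)) \<sim>[at_right 0] (\<lambda>z. L0 y * H k z)"
  shows "((\<lambda>z. (LINT y:{z<..}|lborel. y * p y * H k (z / y)) / H k z) \<longlongrightarrow>
           (LINT y:{0<..}|lebesgue. y * p y * L0 y)) (at_right 0)"
proof (rule tendsto_at_right_sequentially[where b = 1])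
  \<comment> \<open>The choice \<open>b = 1\<close> confines the sequence to the unit interval,
    where \<open>bound\<close> applies.\<close>
  fix u :: "nat \<Rightarrow> real"
  assume u: "\<And>n. 0 < u n" "\<And>n. u n < 1" "u \<longlonglongrightarrow> 0"
  define s where "s n y = indicator {u n<..} y * (y * p y) * H k (u n / y) / H k (u n)" for n y
  have s: "(LINT y:{u n<..}|lborel. y * p y * H k (u n / y)) / H k (u n) = (LINT y|lebesgue. s n y)" for n
  proof -
    have "(LINT y|lebesgue. s n y) = (LINT y|lborel. s n y)"
      by (rule integral_completion) (simp add: s_def)
    also have "\<dots> = (LINT y|lborel. indicator {u n<..} y * (y * p y) * H k (u n / y)) / H k (u n)"
      unfolding s_def by simp
    finally show ?thesis
      by (simp add: set_lebesgue_integral_def mult.assoc)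
  qed
  have u_at_right: "filterlim u (at_right 0) sequentially"
    unfolding filterlim_at using u(1) by (auto simp: u(3) less_imp_neq[symmetric] intro!: always_eventually)
  have "(\<lambda>n. LINT y|lebesgue. s n y) \<longlonglongrightarrow> (LINT y|lebesgue. indicator {0<..} y *\<^sub>R (y * p y * L0 y))"
  proof (rule integral_dominated_convergence[where w = "\<lambda>y. indicator {0<..} y *\<^sub>R (y * p y * L y)"])
    have "(\<lambda>y. indicator {0<..} y *\<^sub>R (y * p y * L0 y)) = (\<lambda>y. (y * p y) * (indicator {0<..} y *\<^sub>R L0 y))"
      by (auto simp: fun_eq_iff)
    also have "\<dots> \<in> borel_measurable lebesgue"
      by (intro borel_measurable_times L0_meas[unfolded set_borel_measurable_def] measurable_completion) measurable
    finally show "(\<lambda>y. indicator {0<..} y *\<^sub>R (y * p y * L0 y)) \<in> borel_measurable lebesgue" .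
    show "s n \<in> borel_measurable lebesgue" for n
      unfolding s_def by (intro measurable_completion) measurable
    show "integrable lebesgue (\<lambda>y. indicator {0<..} y *\<^sub>R (y * p y * L y))"
      using int by (simp add: set_integrable_def)
    show "AE y in lebesgue. (\<lambda>n. s n y) \<longlonglongrightarrow> indicator {0<..} y *\<^sub>R (y * p y * L0 y)"
    proof (intro AE_I2)
      fix y :: real
      show "(\<lambda>n. s n y) \<longlonglongrightarrow> indicator {0<..} y *\<^sub>R (y * p y * L0 y)"
      proof (cases "0 < y")
        case True
        have "((\<lambda>z. H k (z / y) / H k z) \<longlongrightarrow> L0 y) (at_right 0)"
        proof -
          \<comment> \<open>Since \<open>H k z\<close> is positive for positive \<open>z\<close>,
            the asymptotic equivalence may be divided by it and becomes an ordinary limit.\<close>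
          have "(\<lambda>z. H k (z / y) / H k z) \<sim>[at_right 0] (\<lambda>z. L0 y * H k z / H k z)"
            by (intro asymp_equiv_intros equiv True)
          also have "(\<lambda>z. L0 y * H k z / H k z) \<sim>[at_right 0] (\<lambda>z. L0 y)"
          proof (rule asymp_equiv_refl_ev)
            show "\<forall>\<^sub>F z in at_right 0. L0 y * H k z / H k z = L0 y"
              using eventually_at_right_less[of 0]
            proof eventually_elim
              case (elim z)
              then show ?case using H_pos[of z] by simp
            qed
          qed
          finally show ?thesis by (rule asymp_equivD_const)
        qed
        then have "(\<lambda>n. H k (u n / y) / H k (u n)) \<longlonglongrightarrow> L0 y"
          using u_at_right by (rule filterlim_compose)
        moreover have "\<forall>\<^sub>F n in sequentially. indicator {u n<..} y = (1::real)"
          using order_tendstoD(2)[OF u(3) True] by eventually_elim simp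
        ultimately have "(\<lambda>n. indicator {u n<..} y * (y * p y) * (H k (u n / y) / H k (u n))) \<longlonglongrightarrow> 1 * (y * p y) * L0 y"
          by (intro tendsto_mult tendsto_const) (auto intro: tendsto_eventually)
        then show ?thesis using True by (simp add: s_def)
      next
        case False
        then have "s n y = 0" for n using u(1)[of n] by (simp add: s_def)
        then show ?thesis using False by simp
      qed
    qed
    show "AE y in lebesgue. norm (s n y) \<le> indicator {0<..} y *\<^sub>R (y * p y * L y)" for n
    proof (intro AE_I2)
      fix y :: real
      show "norm (s n y) \<le> indicator {0<..} y *\<^sub>R (y * p y * L y)"
      proof (cases "u n < y")
        case True
        then have y: "0 < y" using u(1)[of n] by simp
        have "H k (u n / y) / H k (u n) \<le> L y"
          using bound[of "u n" y] u True H_pos[of "u n"] by (simp add: divide_le_eq)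
        then have "y * p y * (H k (u n / y) / H k (u n)) \<le> y * p y * L y"
          using y p[of y] by (intro mult_left_mono) auto
        then show ?thesis using True y p[of y] H_nonneg by (simp add: s_def abs_mult)
      next
        case False
        have "0 \<le> L y" if "0 < y"
        proof -
          \<comment> \<open>A point of the unit interval below \<open>y\<close>. Evaluating
            \<open>bound\<close> there, with \<open>H k\<close> positive at this point, shows that
            \<open>L y\<close> is nonnegative.\<close>
          have z: "min (y / 2) (1 / 2) \<in> {0<..<1}" "min (y / 2) (1 / 2) < y" using that by auto
          from bound[OF this] H_nonneg[of "min (y / 2) (1 / 2) / y"] H_pos[of "min (y / 2) (1 / 2)"] z(1)
          show ?thesis by (metis greaterThanLessThan_iff order_trans zero_le_mult_iff not_less)
        qed
        then show ?thesis using False p[of y] by (auto simp: s_def split: split_indicator)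
      qed
    qed
  qed
  then show "(\<lambda>n. (LINT y:{u n<..}|lborel. y * p y * H k (u n / y)) / H k (u n)) \<longlonglongrightarrow> (LINT y:{0<..}|lebesgue. y * p y * L0 y)"
    by (simp only: s set_lebesgue_integral_def[of lebesgue])
qed simp

text \<open>The flux relation says that \<open>f z / z\<close> has derivative
  \<open>- (G z / z\<^sup>2)\<close>, while the comparison integral has derivative
  \<open>- (H k z / z\<^sup>2)\<close> and diverges. The quotient of the derivatives is
  \<open>G z / H k z\<close>, so l'Hopital's rule gives the limit \<open>\<Lambda>\<close>; as
  \<open>\<Lambda>\<close> is nonzero, it can be divided out.\<close>

lemma asymp_equiv_of_flux:
  fixes f f1 G :: "real \<Rightarrow> real"
  assumes f1: "\<And>x. 0 < x \<Longrightarrow> (f has_real_derivative f1 x) (at x)"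
    and flux: "\<And>z. 0 < z \<Longrightarrow> f z - z * f1 z = G z"
    and lim: "((\<lambda>z. G z / H k z) \<longlongrightarrow> \<Lambda>) (at_right 0)" and \<Lambda>: "\<Lambda> \<noteq> 0"
  shows "f \<sim>[at_right 0] (\<lambda>z. \<Lambda> * z * (LINT y:{z..1}|lborel. H k y / y\<^sup>2))"
proof -
  define P where "P z = (LINT y:{z..1}|lborel. H k y / y\<^sup>2)" for z
  have pos: "\<forall>\<^sub>F z::real in at_right 0. 0 < z" by (rule eventually_at_right_less)
  have "((\<lambda>z. (f z / z) / P z) \<longlongrightarrow> \<Lambda>) (at_right 0)"
  proof (rule lhopital_right_at_top)
    show "filterlim P at_top (at_right 0)"
      unfolding P_def by (rule H_div_square_integral_at_top)
    show "\<forall>\<^sub>F z in at_right 0. - (H k z / z\<^sup>2) \<noteq> 0"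
      using pos by eventually_elim (use H_pos in force)
    show "\<forall>\<^sub>F z in at_right 0. ((\<lambda>z. f z / z) has_real_derivative - (G z / z\<^sup>2)) (at z)"
      using pos
    proof eventually_elim
      case (elim z)
      have "((\<lambda>z. f z / z) has_real_derivative (f1 z * z - f z * 1) / (z * z)) (at z)"
        using elim by (intro DERIV_divide f1 DERIV_ident) auto
      moreover have "(f1 z * z - f z * 1) / (z * z) = - (G z / z\<^sup>2)"
        using elim unfolding flux[OF elim, symmetric] by (simp add: power2_eq_square divide_simps)
      ultimately show ?case by simp
    qed
    show "\<forall>\<^sub>F z in at_right 0. (P has_real_derivative - (H k z / z\<^sup>2)) (at z)"
      unfolding P_def
      by (rule eventually_mono[OF eventually_at_right_real[OF zero_less_one]])
         (intro H_div_square_integral_deriv, auto)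
    show "((\<lambda>z. - (G z / z\<^sup>2) / - (H k z / z\<^sup>2)) \<longlongrightarrow> \<Lambda>) (at_right 0)"
      by (rule Lim_transform_eventually[OF lim]) (use pos in eventually_elim, simp)
  qed
  from tendsto_divide[OF this tendsto_const[of \<Lambda>]] \<Lambda>
  have "((\<lambda>z. f z / z / P z / \<Lambda>) \<longlongrightarrow> 1) (at_right 0)" by simp
  then have "((\<lambda>z. f z / (\<Lambda> * z * P z)) \<longlongrightarrow> 1) (at_right 0)"
    by (simp add: mult_ac)
  then show ?thesis
    unfolding P_def by (rule asymp_equivI')
qed

end

section \<open>From the given coefficients to Borel representatives, and conclusion\<close>

theorem proposition3p4:
  fixes a f h L L0 :: "real \<Rightarrow> real" and b :: "real \<Rightarrow> real \<Rightarrow> real"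
  assumes "overall_fragmentation_rate a"
    and "daughter_distribution b"
    and "stationary_solution a b f"
    and "\<And>x y. 0 < x \<Longrightarrow> x < y \<Longrightarrow> b x y = 1 / y * h (x / y)"
    and "\<And>z. z \<in> {0<..<1} \<Longrightarrow> 0 \<le> h z"
    and "set_integrable lebesgue {0<..<1} (\<lambda>z. z * h z)"
    and "(LINT z:{0<..<1}|lebesgue. z * h z) = 1"
    and "\<not> set_integrable lebesgue {0<..<1} h"
    and "L \<in> borel_measurable (lebesgue_on {0<..})"
    and "L0 \<in> borel_measurable (lebesgue_on {0<..})"
    and "\<And>y. y > 0 \<Longrightarrow> 0 < L y"
    and "\<And>y. y > 0 \<Longrightarrow> 0 < L0 y"
    and "\<And>y. y > 0 \<Longrightarrow> L0 y \<le> L y"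
    and "\<And>z y. z \<in> {0<..<1} \<Longrightarrow> y \<in> {z<..} \<Longrightarrow> H h (z / y) \<le> L y * H h z"
    and "\<And>y. y > 0 \<Longrightarrow> (\<lambda>z. H h (z / y)) \<sim>[at_right 0] (\<lambda>z. L0 y * H h z)"
    and "set_integrable lebesgue {0<..} (\<lambda>y. y * a y * L y * f y)"
  shows "set_integrable lebesgue {0<..} (\<lambda>y. y * a y * L0 y * f y) \<and>
    (let \<Lambda>0 = (LINT y:{0<..}|lebesgue. y * a y * L0 y * f y)
     in f \<sim>[at_right 0] (\<lambda>z. \<Lambda>0 * z * (LINT y:{z..1}|lebesgue. H h y / y\<^sup>2)))"
proof -
  note b_eq = assms(4) and h_nonneg = assms(5) and L_pos = assms(11) and L0_pos = assms(12)
    and L0_le = assms(13) and H_bound = assms(14) and H_equiv = assms(15) and L_int = assms(16)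
  have a_pos: "AE x in lborel. 0 < x \<longrightarrow> 0 < a x"
    using assms(1) unfolding overall_fragmentation_rate_def
    by (simp add: AE_restrict_space_iff AE_completion_iff)
  have sol: "continuous_on {0..} f" "smooth_on {0<..} f" "\<And>x. 0 \<le> x \<Longrightarrow> 0 \<le> f x"
    "AE x in lborel. 0 < x \<longrightarrow>
        - deriv (deriv f) x + a x * f x = (LINT y:{x<..}|lebesgue. a y * b x y * f y)"
    "f \<in> X 0" "(\<lambda>x. a x * f x) \<in> X 0" "(\<lambda>x. a x * f x) \<in> X 1" "deriv (deriv f) \<in> X 1"
    "(LINT x:{0<..}|lebesgue. x * f x) = 1"
    using assms(3) unfolding stationary_solution_def
    by (auto simp: AE_restrict_space_iff AE_completion_iff)

  have diff: "(deriv ^^ n) f differentiable_on {0<..}" for n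
    using sol(2) by (simp add: smooth_on_def)
  have deriv: "((deriv ^^ n) f has_real_derivative deriv ((deriv ^^ n) f) x) (at x)" if "0 < x" for n x
    using diff[of n] that unfolding differentiable_on_def
    by (auto simp: at_within_open[of _ "{0<..}"] DERIV_deriv_iff_real_differentiable)
  have f1: "(f has_real_derivative deriv f x) (at x)" if "0 < x" for x
    using deriv[OF that, of 0] by simp
  have f2: "(deriv f has_real_derivative deriv (deriv f) x) (at x)" if "0 < x" for x
    using deriv[OF that, of 1] by simp
  have f2_cont: "continuous_on {0<..} (deriv (deriv f))"
    using differentiable_imp_continuous_on[OF diff[of 2]] by (simp add: numeral_2_eq_2)

  have X0: "set_integrable lebesgue {0<..} u" if "u \<in> X 0" for u
  proof -
    have "AE x in lborel. x \<in> {0<..} \<longrightarrow> x powr 0 * u x = u x" by simp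
    from set_integrable_lebesgue_cong_AE[OF this] that show ?thesis by (simp only: X_def mem_Collect_eq)
  qed
  have X1: "set_integrable lebesgue {0<..} (\<lambda>x. x * u x)" if "u \<in> X 1" for u
  proof -
    have "AE x in lborel. x \<in> {0<..} \<longrightarrow> x powr 1 * u x = x * u x" by simp
    from set_integrable_lebesgue_cong_AE[OF this] that show ?thesis by (simp only: X_def mem_Collect_eq)
  qed

  obtain p where p_meas: "p \<in> borel_measurable borel" and p_nonneg: "\<And>y. 0 \<le> p y"
    and p_eq: "AE y in lborel. 0 < y \<longrightarrow> a y * f y = p y"
  proof (rule borel_representative[of "{0<..}" "\<lambda>y. a y * f y"])
    show "set_borel_measurable lebesgue {0<..} (\<lambda>y. a y * f y)"
      using X0[OF sol(6)] borel_measurable_integrable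
      unfolding set_integrable_def set_borel_measurable_def by blast
    show "AE x in lebesgue. x \<in> {0<..} \<longrightarrow> 0 \<le> a x * f x"
      using AE_completion[OF a_pos] by eventually_elim (auto intro!: mult_nonneg_nonneg sol(3))
  qed (auto intro: that)

  obtain k where k_meas: "k \<in> borel_measurable borel" and k_nonneg: "\<And>t. 0 \<le> k t"
    and k_supp: "\<And>t. t \<notin> {0<..<1} \<Longrightarrow> k t = 0" and hk: "AE t in lborel. t \<in> {0<..<1} \<longrightarrow> h t = k t"
  proof (rule borel_representative[of "{0<..<1}" h])
    \<comment> \<open>Measurability of \<open>h\<close> is recovered from that of
      \<open>t * h t\<close> through division by \<open>t\<close>.\<close>
    have "(\<lambda>t. indicator {0<..<1} t *\<^sub>R (t * h t)) \<in> borel_measurable lebesgue"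
      using assms(6) borel_measurable_integrable unfolding set_integrable_def by blast
    moreover have "(\<lambda>t::real. t) \<in> borel_measurable lebesgue"
      by (rule measurable_completion) measurable
    ultimately have "(\<lambda>t. (indicator {0<..<1} t *\<^sub>R (t * h t)) / t) \<in> borel_measurable lebesgue"
      by (rule borel_measurable_divide)
    also have "(\<lambda>t. (indicator {0<..<1} t *\<^sub>R (t * h t)) / t) = (\<lambda>t. indicator {0<..<1} t *\<^sub>R h t)"
      by (auto simp: fun_eq_iff split: split_indicator)
    finally show "set_borel_measurable lebesgue {0<..<1} h"
      by (simp add: set_borel_measurable_def)
    show "AE x in lebesgue. x \<in> {0<..<1} \<longrightarrow> 0 \<le> h x"
      using h_nonneg by (intro AE_I2) auto
  qed (auto intro: that)

  have hk_moment: "AE t in lborel. t \<in> {0<..<1} \<longrightarrow> t * h t = t * k t"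
    using hk by eventually_elim auto
  have k_lborel: "(LINT t:{0<..<1}|lebesgue. t * k t) = (LINT t|lborel. t * k t)"
  proof -
    have "(LINT t:{0<..<1}|lebesgue. t * k t) = (LINT t|lebesgue. t * k t)"
      unfolding set_lebesgue_integral_def using k_supp
      by (intro Bochner_Integration.integral_cong) (auto split: split_indicator)
    also have "\<dots> = (LINT t|lborel. t * k t)"
      using k_meas by (intro integral_completion) measurable
    finally show ?thesis .
  qed
  \<comment> \<open>Applied below with \<open>c\<close> the identity, for the first moment, and with
    \<open>c\<close> constantly 1, for the failure of integrability.\<close>
  have restrict: "set_integrable lebesgue {0<..<1} (\<lambda>t. c t * k t) \<longleftrightarrow> integrable lborel (\<lambda>t. c t * k t)"
    if "c \<in> borel_measurable borel" for c
  proof -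
    have "set_integrable lebesgue {0<..<1} (\<lambda>t. c t * k t) \<longleftrightarrow> set_integrable lborel {0<..<1} (\<lambda>t. c t * k t)"
      using that k_meas by (intro set_integrable_lebesgue_iff) auto
    also have "\<dots> \<longleftrightarrow> integrable lborel (\<lambda>t. c t * k t)"
      unfolding set_integrable_def using k_supp
      by (intro Bochner_Integration.integrable_cong) (auto split: split_indicator)
    finally show ?thesis .
  qed
  note [measurable] = p_meas
  interpret fragment_profile k
  proof
    show "integrable lborel (\<lambda>t. t * k t)"
      using assms(6) set_integrable_lebesgue_cong_AE[OF hk_moment] restrict[of "\<lambda>t. t"] by simp
    show "(LINT t|lborel. t * k t) = 1"
      using assms(7) set_integral_lebesgue_cong_AE[OF hk_moment] k_lborel by simp
    show "\<not> integrable lborel k"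
      using assms(8) set_integrable_lebesgue_cong_AE[OF hk] restrict[of "\<lambda>t. 1"] by simp
  qed (fact k_meas k_nonneg k_supp)+

  \<comment> \<open>Beyond 1 the values of \<open>h\<close> are arbitrary whereas \<open>k\<close>
    vanishes, hence the restriction on \<open>z\<close>.\<close>
  have Hk: "H h z = H k z" if "z \<le> 1" for z
    unfolding H_def
  proof (rule set_integral_lebesgue_cong_AE)
    show "AE t in lborel. t \<in> {0<..<z} \<longrightarrow> t * h t = t * k t"
      using hk_moment by eventually_elim (use that in auto)
  qed

  have p_int: "set_integrable lborel {0<..} (\<lambda>y. y * p y)"
  proof -
    have "AE y in lborel. y \<in> {0<..} \<longrightarrow> y * (a y * f y) = y * p y"
      using p_eq by eventually_elim auto
    from set_integrable_lebesgue_cong_AE[OF this] X1[OF sol(7)] p_meas show ?thesis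
      by (simp add: set_integrable_lebesgue_iff)
  qed
  \<comment> \<open>Continuity supplies the Borel measurability needed to descend from Lebesgue
    measure.\<close>
  have lborel_cont: "set_integrable lborel {0<..} u"
    if "set_integrable lebesgue {0<..} u" "continuous_on {0<..} u" for u :: "real \<Rightarrow> real"
    using that borel_measurable_continuous_on_indicator[of "{0<..}" u]
    unfolding set_integrable_def by (subst (asm) integrable_completion) auto
  have gain: "AE x in lborel. 0 < x \<longrightarrow>
     p x - deriv (deriv f) x = enn2real (\<integral>\<^sup>+y. ennreal (indicator {x<..} y * (p y / y * k (x / y))) \<partial>lborel)"
    using sol(4) p_eq
  proof eventually_elim
    case (elim x)
    show ?case
    proof
      assume x: "0 < x"
      \<comment> \<open>The null set where \<open>h\<close> and \<open>k\<close> differ is carried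
        from \<open>t = x / y\<close> to the variable \<open>y\<close>.\<close>
      have "AE y in lborel. y \<in> {x<..} \<longrightarrow> a y * b x y * f y = p y / y * k (x / y)"
        using p_eq AE_lborel_compose_divide[OF hk x]
      proof eventually_elim
        case (elim y)
        show ?case
        proof
          assume y: "y \<in> {x<..}"
          then have "a y * b x y * f y = (a y * f y) / y * h (x / y)"
            using x b_eq[of x y] by simp
          also have "\<dots> = p y / y * k (x / y)" using elim x y by simp
          finally show "a y * b x y * f y = p y / y * k (x / y)" .
        qed
      qed
      then have "(LINT y:{x<..}|lebesgue. a y * b x y * f y) = (LINT y:{x<..}|lebesgue. p y / y * k (x / y))"
        by (rule set_integral_lebesgue_cong_AE)
      also have "\<dots> = (LINT y|lborel. indicator {x<..} y * (p y / y * k (x / y)))"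
        unfolding set_lebesgue_integral_def real_scaleR_def
        by (intro integral_completion) measurable
      \<comment> \<open>This holds even if the nonnegative integral is infinite, since both sides
        are then 0.\<close>
      also have "\<dots> = enn2real (\<integral>\<^sup>+y. ennreal (indicator {x<..} y * (p y / y * k (x / y))) \<partial>lborel)"
      proof (rule integral_eq_nn_integral)
        show "AE y in lborel. 0 \<le> indicator {x<..} y * (p y / y * k (x / y))"
          using p_nonneg k_nonneg x by (intro AE_I2) (auto split: split_indicator)
      qed measurable
      finally show "p x - deriv (deriv f) x = enn2real (\<integral>\<^sup>+y. ennreal (indicator {x<..} y * (p y / y * k (x / y))) \<partial>lborel)"
        using elim x by simp
    qed
  qed
  have flux: "f z - z * deriv f z = (LINT y:{z<..}|lborel. y * p y * H k (z / y))" if "0 < z" for z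
  proof (rule flux_identity[OF f1 f2 f2_cont _ _ _ p_meas p_nonneg p_int gain that])
    show "set_integrable lborel {0<..} (\<lambda>x. x * deriv (deriv f) x)"
      by (intro lborel_cont X1 sol(8) continuous_intros f2_cont)
    show "set_integrable lborel {0<..} f"
      by (intro lborel_cont X0 sol(5) continuous_on_subset[OF sol(1)]) auto
  qed (auto intro: sol(3))

  have p_weight: "AE y in lborel. y \<in> {0<..} \<longrightarrow> y * a y * M y * f y = y * p y * M y" for M :: "real \<Rightarrow> real"
    using p_eq by eventually_elim auto
  have L0_meas: "set_borel_measurable lebesgue {0<..} L0"
    using assms(10) by (simp add: set_borel_measurable_def borel_measurable_restrict_space_iff)
  have int_L: "set_integrable lebesgue {0<..} (\<lambda>y. y * p y * L y)"
    using L_int set_integrable_lebesgue_cong_AE[OF p_weight] by blast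
  have int_L0: "set_integrable lebesgue {0<..} (\<lambda>y. y * p y * L0 y)"
    unfolding set_integrable_def
  proof (rule Bochner_Integration.integrable_bound[OF int_L[unfolded set_integrable_def]])
    have "(\<lambda>y. (y * p y) * (indicator {0<..} y *\<^sub>R L0 y)) \<in> borel_measurable lebesgue"
      by (intro borel_measurable_times L0_meas[unfolded set_borel_measurable_def] measurable_completion) measurable
    also have "(\<lambda>y. (y * p y) * (indicator {0<..} y *\<^sub>R L0 y)) = (\<lambda>y. indicator {0<..} y *\<^sub>R (y * p y * L0 y))"
      by (auto simp: fun_eq_iff)
    finally show "\<dots> \<in> borel_measurable lebesgue" .
    show "AE y in lebesgue. norm (indicator {0<..} y *\<^sub>R (y * p y * L0 y)) \<le> norm (indicator {0<..} y *\<^sub>R (y * p y * L y))"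
      using p_nonneg L0_pos L_pos L0_le
      by (intro AE_I2) (auto simp: abs_mult less_imp_le intro!: mult_left_mono split: split_indicator)
  qed
  define \<Lambda> where "\<Lambda> = (LINT y:{0<..}|lebesgue. y * a y * L0 y * f y)"
  have \<Lambda>: "\<Lambda> = (LINT y:{0<..}|lebesgue. y * p y * L0 y)"
    unfolding \<Lambda>_def by (rule set_integral_lebesgue_cong_AE[OF p_weight])
  \<comment> \<open>A vanishing integral of the nonnegative \<open>y * p y * L0 y\<close> would, by
    positivity of \<open>a\<close> and \<open>L0\<close>, force \<open>f\<close> to be 0 almost
    everywhere, against its first moment being 1.\<close>
  have "\<Lambda> \<noteq> 0"
  proof
    assume "\<Lambda> = 0"
    then have "AE y in lebesgue. indicator {0<..} y *\<^sub>R (y * p y * L0 y) = 0"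
      using p_nonneg L0_pos int_L0 unfolding \<Lambda> set_lebesgue_integral_def set_integrable_def
      by (subst (asm) integral_nonneg_eq_0_iff_AE) (auto simp: less_imp_le split: split_indicator)
    then have "AE y in lborel. indicator {0<..} y *\<^sub>R (y * p y * L0 y) = 0"
      by (simp add: AE_completion_iff)
    then have "AE y in lborel. y \<in> {0<..} \<longrightarrow> y * f y = 0"
      using p_eq a_pos
    proof eventually_elim
      case (elim y)
      show ?case using elim L0_pos[of y] by auto
    qed
    from set_integral_lebesgue_cong_AE[OF this] sol(9) show False
      by (simp add: set_lebesgue_integral_def)
  qed
  have "((\<lambda>z. (LINT y:{z<..}|lborel. y * p y * H k (z / y)) / H k z) \<longlongrightarrow> \<Lambda>) (at_right 0)"
    unfolding \<Lambda>
  proof (rule flux_div_H_tendsto[OF p_meas p_nonneg L0_meas int_L])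
    show "H k (z / y) \<le> L y * H k z" if "z \<in> {0<..<1}" "z < y" for z y
      using H_bound[of z y] that by (simp add: Hk)
    show "(\<lambda>z. H k (z / y)) \<sim>[at_right 0] (\<lambda>z. L0 y * H k z)" if "0 < y" for y
    proof (rule asymp_equiv_transfer[OF H_equiv[OF that]])
      \<comment> \<open>Both \<open>z\<close> and \<open>z / y\<close> must lie below 1 for
        \<open>H h\<close> to be exchanged with \<open>H k\<close>.\<close>
      have *: "\<forall>\<^sub>F z in at_right 0. z \<in> {0<..<min 1 y}"
        using that by (intro eventually_at_right_real) auto
      then show "\<forall>\<^sub>F z in at_right 0. H h (z / y) = H k (z / y)"
        by eventually_elim (intro Hk, use that in auto)
      from * show "\<forall>\<^sub>F z in at_right 0. L0 y * H h z = L0 y * H k z"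
        by eventually_elim (simp add: Hk)
    qed
  qed
  from asymp_equiv_of_flux[OF f1 flux this \<open>\<Lambda> \<noteq> 0\<close>]
  have "f \<sim>[at_right 0] (\<lambda>z. \<Lambda> * z * (LINT y:{z..1}|lborel. H k y / y\<^sup>2))" .
  moreover have "(LINT y:{z..1}|lborel. H k y / y\<^sup>2) = (LINT y:{z..1}|lebesgue. H h y / y\<^sup>2)" for z
  proof -
    have "(LINT y:{z..1}|lebesgue. H h y / y\<^sup>2) = (LINT y:{z..1}|lebesgue. H k y / y\<^sup>2)"
      unfolding set_lebesgue_integral_def
      by (intro Bochner_Integration.integral_cong) (auto simp: Hk split: split_indicator)
    also have "\<dots> = (LINT y:{z..1}|lborel. H k y / y\<^sup>2)"
      unfolding set_lebesgue_integral_def by (intro integral_completion) measurable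
    finally show ?thesis by simp
  qed
  moreover have "set_integrable lebesgue {0<..} (\<lambda>y. y * a y * L0 y * f y)"
    using int_L0 set_integrable_lebesgue_cong_AE[OF p_weight] by blast
  ultimately show ?thesis
    unfolding Let_def \<Lambda>_def by simp
qed

end
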